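(* Let $\mathcal{L}$ be a linear network with resistance metric $\mathrm{d}_R$, and let $q$ be a positive integer. Let $a_i,b_i:\mathcal{L}\to(0,\infty)$, $i=1,\dots,q$, be functions, and define $\alpha_{ij}(s,t)=[a_i(s)+a_j(t)]/2$ for $s,t\in\mathcal{L}$. Let $\boldsymbol{\beta}=[\beta_{ij}]_{i,j=1}^q$ be a (real) symmetric positive semidefinite matrix, and let $F$ be a positive finite measure on $(0,\infty)$. Then the matrix-valued function $\boldsymbol{K}:\mathcal{L}\times\mathcal{L}\to\mathbb{R}^{q\times q}$ with entries $$K_{ij}(s,t)=\int_0^\infty\frac{\beta_{ij}\sqrt{b_i(s)b_j(t)}}{\sqrt{\alpha_{ij}(s,t)+\mathrm{d}_R(s,t)\,w}}\,\mathrm{d}F(w),\qquad s,t\in\mathcal{L},\ i,j=1,\dots,q,$$ is positive semidefinite.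
   Context: Linear network: $\mathcal{L}=\bigcup_{i=1}^m\ell_i\subset\mathbb{R}^2$ is a finite union ($m<\infty$) of closed line segments, each of positive finite length $|\ell_i|$ and intersecting other segments only at endpoints; $\mathcal{L}$ is assumed path-connected. Graph and matrix $\boldsymbol{\Delta}$: let $\mathcal{V}=\{v_1,\dots,v_n\}$ be the set of endpoints of the segments. Write $v_i\sim v_j$ if the distinct vertices $v_i,v_j$ are the two endpoints of one of the segments. Set $\mathrm{con}(v_i,v_j)=1/\|v_i-v_j\|$ (Euclidean norm) if $v_i\sim v_j$ and $\mathrm{con}(v_i,v_j)=0$ otherwise, and $c(v_i)=\sum_{v\sim v_i}\mathrm{con}(v_i,v)$. Fix an arbitrary reference vertex $v^*\in\mathcal{V}$ (the resulting resistance metric does not depend on this choice). The $n\times n$ matrix $\boldsymbol{\Delta}$ indexed by $\mathcal{V}$ has entries $\boldsymbol{\Delta}(v^*,v^* )=1+c(v^* )$, $\boldsymbol{\Delta}(v_i,v_i)=c(v_i)$ for $v_i\ne v^*$, and $\boldsymbol{\Delta}(v_i,v_j)=-\mathrm{con}(v_i,v_j)$ for $v_i\neq v_j$. It is strictly positive definite. Auxiliary Gaussian random field: $A(s)=A_0(s)+\sum_{i=1}^m A_i(s)$, $s\in\mathcal{L}$, where $A_0,\dots,A_m$ are independent Gaussian random fields such that: (i) $(A_0(v_1),\dots,A_0(v_n))^\top\sim\mathcal{N}_n(\mathbf{0},\boldsymbol{\Delta}^{-1})$, and $A_0$ is extended to each segment by linear interpolation (in arc length) between the values at its endpoints; (ii)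 for $i=1,\dots,m$, $A_i(s)=B_i(s)$ for $s\in\ell_i$ and $A_i(s)=0$ for $s\in\mathcal{L}\setminus\ell_i$, where $B_1,\dots,B_m$ are independent standard Brownian bridges, $B_i$ being defined on an interval of length $|\ell_i|$ (starting and ending at zero), identified with $\ell_i$ through arc length parameterization, and independent of $A_0$. Resistance metric: $\mathrm{d}_R(s,t)=\mathrm{var}[A(s)-A(t)]$, $s,t\in\mathcal{L}$. A matrix-valued function $\boldsymbol{K}:\mathcal{L}\times\mathcal{L}\to\mathbb{R}^{q\times q}$ is positive semidefinite if for every $N\in\mathbb{N}$ and all $s_1,\dots,s_N\in\mathcal{L}$ the $Nq\times Nq$ block matrix whose $(k,l)$ block is $\boldsymbol{K}(s_k,s_l)$ is positive semidefinite. *)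

theory Defs
  imports "HOL-Probability.Probability"
begin

text \<open>
  The segment with index \<open>i \<in> {1..m}\<close> is given by the pair \<open>e i\<close> of its two endpoints. The order
  of the pair only fixes the direction of the arc length parameterization.
\<close>

definition seg :: "(nat \<Rightarrow> (real^2) \<times> (real^2)) \<Rightarrow> nat \<Rightarrow> (real^2) set" where
  "seg e i = closed_segment (fst (e i)) (snd (e i))"

definition endpoints :: "(nat \<Rightarrow> (real^2) \<times> (real^2)) \<Rightarrow> nat \<Rightarrow> (real^2) set" where
  "endpoints e i = {fst (e i), snd (e i)}"

definition seg_length :: "(nat \<Rightarrow> (real^2) \<times> (real^2)) \<Rightarrow> nat \<Rightarrow> real" where
  "seg_length e i = dist (fst (e i)) (snd (e i))"

definition network :: "nat \<Rightarrow> (nat \<Rightarrow> (real^2) \<times> (real^2)) \<Rightarrow> (real^2) set" where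
  "network m e = (\<Union>i\<in>{1..m}. seg e i)"

text \<open>
  A common point of two segments is an endpoint of both: an endpoint of one segment may not lie in
  the relative interior of another. Hence no two segments have the same pair of endpoints.
\<close>

definition linear_network :: "nat \<Rightarrow> (nat \<Rightarrow> (real^2) \<times> (real^2)) \<Rightarrow> bool" where
  "linear_network m e \<longleftrightarrow>
     1 \<le> m \<and>
     (\<forall>i\<in>{1..m}. 0 < seg_length e i) \<and>
     (\<forall>i\<in>{1..m}. \<forall>j\<in>{1..m}. i \<noteq> j \<longrightarrow> seg e i \<inter> seg e j \<subseteq> endpoints e i \<inter> endpoints e j) \<and>
     path_connected (network m e)"

definition vertices :: "nat \<Rightarrow> (nat \<Rightarrow> (real^2) \<times> (real^2)) \<Rightarrow> (real^2) set" where
  "vertices m e = (\<Union>i\<in>{1..m}. endpoints e i)"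

definition adjacent :: "nat \<Rightarrow> (nat \<Rightarrow> (real^2) \<times> (real^2)) \<Rightarrow> real^2 \<Rightarrow> real^2 \<Rightarrow> bool" where
  "adjacent m e x y \<longleftrightarrow> x \<noteq> y \<and> (\<exists>i\<in>{1..m}. endpoints e i = {x, y})"

definition con :: "nat \<Rightarrow> (nat \<Rightarrow> (real^2) \<times> (real^2)) \<Rightarrow> real^2 \<Rightarrow> real^2 \<Rightarrow> real" where
  "con m e x y = (if adjacent m e x y then 1 / norm (x - y) else 0)"

definition total_con :: "nat \<Rightarrow> (nat \<Rightarrow> (real^2) \<times> (real^2)) \<Rightarrow> real^2 \<Rightarrow> real" where
  "total_con m e x = (\<Sum>y\<in>{y \<in> vertices m e. adjacent m e y x}. con m e x y)"

text \<open>
  Here \<open>v\<close> enumerates the vertices by a finite index type, and \<open>v r\<close> is the reference vertex.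
\<close>

definition Delta ::
    "nat \<Rightarrow> (nat \<Rightarrow> (real^2) \<times> (real^2)) \<Rightarrow> ('n::finite \<Rightarrow> real^2) \<Rightarrow> 'n \<Rightarrow> real^'n^'n" where
  "Delta m e v r =
     (\<chi> i j. if i = j then (if i = r then 1 + total_con m e (v i) else total_con m e (v i))
             else - con m e (v i) (v j))"

text \<open>Variance zero is allowed and gives the point mass at the mean.\<close>

definition normal_law :: "real \<Rightarrow> real \<Rightarrow> real measure" where
  "normal_law \<mu> V =
     (if V = 0 then return borel \<mu>
      else density lborel (\<lambda>x. ennreal (normal_density \<mu> (sqrt V) x)))"

text \<open>
  Centred, jointly Gaussian with covariance function \<open>C\<close>: every finite linear combination is
  univariate normal with mean zero and the variance prescribed by \<open>C\<close>. For a finite index set this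
  is the multivariate normal law with mean \<open>0\<close> and covariance matrix \<open>C\<close>.
\<close>

definition centred_gaussian ::
    "'w measure \<Rightarrow> 'i set \<Rightarrow> ('i \<Rightarrow> 'w \<Rightarrow> real) \<Rightarrow> ('i \<Rightarrow> 'i \<Rightarrow> real) \<Rightarrow> bool" where
  "centred_gaussian M T X C \<longleftrightarrow>
     (\<forall>t\<in>T. X t \<in> borel_measurable M) \<and>
     (\<forall>J x. finite J \<and> J \<subseteq> T \<longrightarrow>
        distr M borel (\<lambda>\<omega>. \<Sum>t\<in>J. x t * X t \<omega>)
          = normal_law 0 (\<Sum>s\<in>J. \<Sum>t\<in>J. x s * C s t * x t))"

text \<open>
  The standard Brownian bridge on \<open>[0, l]\<close>. The covariance makes it vanish almost surely at
  \<open>0\<close> and at \<open>l\<close>.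
\<close>

definition brownian_bridge :: "'w measure \<Rightarrow> real \<Rightarrow> (real \<Rightarrow> 'w \<Rightarrow> real) \<Rightarrow> bool" where
  "brownian_bridge M l B \<longleftrightarrow>
     centred_gaussian M {0..l} B (\<lambda>s t. min s t - s * t / l) \<and>
     (AE \<omega> in M. continuous_on {0..l} (\<lambda>u. B u \<omega>))"

text \<open>
  \<open>A 0, \<dots>, A m\<close> are the independent summands of the auxiliary field. Independence is that of
  the random functions on the network, with the product sigma-algebra. On segment \<open>i\<close> the arc
  length parameter of a point is its distance to \<open>fst (e i)\<close>.
\<close>

definition auxiliary_fields ::
    "'w measure \<Rightarrow> nat \<Rightarrow> (nat \<Rightarrow> (real^2) \<times> (real^2)) \<Rightarrow> ('n::finite \<Rightarrow> real^2) \<Rightarrow> 'n \<Rightarrow>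
     (nat \<Rightarrow> real^2 \<Rightarrow> 'w \<Rightarrow> real) \<Rightarrow> bool" where
  "auxiliary_fields M m e v r A \<longleftrightarrow>
     prob_space M \<and>
     prob_space.indep_vars M (\<lambda>_. PiM (network m e) (\<lambda>_. borel))
       (\<lambda>i \<omega>. \<lambda>s\<in>network m e. A i s \<omega>) {0..m} \<and>
     centred_gaussian M UNIV (\<lambda>j. A 0 (v j)) (\<lambda>i j. matrix_inv (Delta m e v r) $ i $ j) \<and>
     (\<forall>i\<in>{1..m}. \<forall>u\<in>{0..1}. \<forall>\<omega>\<in>space M.
        A 0 ((1 - u) *\<^sub>R fst (e i) + u *\<^sub>R snd (e i)) \<omega>
          = (1 - u) * A 0 (fst (e i)) \<omega> + u * A 0 (snd (e i)) \<omega>) \<and>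
     (\<forall>i\<in>{1..m}. \<exists>B. brownian_bridge M (seg_length e i) B \<and>
        (\<forall>s\<in>network m e. \<forall>\<omega>\<in>space M.
           A i s \<omega> = (if s \<in> seg e i then B (dist (fst (e i)) s) \<omega> else 0)))"

definition total_field ::
    "nat \<Rightarrow> (nat \<Rightarrow> real^2 \<Rightarrow> 'w \<Rightarrow> real) \<Rightarrow> real^2 \<Rightarrow> 'w \<Rightarrow> real" where
  "total_field m A s \<omega> = A 0 s \<omega> + (\<Sum>i=1..m. A i s \<omega>)"

definition resistance_metric ::
    "'w measure \<Rightarrow> nat \<Rightarrow> (nat \<Rightarrow> real^2 \<Rightarrow> 'w \<Rightarrow> real) \<Rightarrow> real^2 \<Rightarrow> real^2 \<Rightarrow> real" where
  "resistance_metric M m A s t =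
     prob_space.variance M (\<lambda>\<omega>. total_field m A s \<omega> - total_field m A t \<omega>)"

text \<open>Real matrices with rows and columns indexed by a finite set; symmetry is part of the notion.\<close>

definition psd_matrix :: "'i set \<Rightarrow> ('i \<Rightarrow> 'i \<Rightarrow> real) \<Rightarrow> bool" where
  "psd_matrix I Q \<longleftrightarrow>
     (\<forall>i\<in>I. \<forall>j\<in>I. Q i j = Q j i) \<and>
     (\<forall>x. 0 \<le> (\<Sum>i\<in>I. \<Sum>j\<in>I. x i * Q i j * x j))"

text \<open>
  The block matrix is indexed by pairs: entry \<open>((k, i), (l, j))\<close> is entry \<open>(i, j)\<close> of block \<open>(k, l)\<close>.
\<close>

definition psd_kernel :: "'p set \<Rightarrow> ('p \<Rightarrow> 'p \<Rightarrow> real^'q^'q) \<Rightarrow> bool" where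
  "psd_kernel L K \<longleftrightarrow>
     (\<forall>N. \<forall>s. (\<forall>k\<in>{1..N::nat}. s k \<in> L) \<longrightarrow>
        psd_matrix ({1..N} \<times> (UNIV :: 'q::finite set))
          (\<lambda>(k, i) (l, j). K (s k) (s l) $ i $ j))"

end

theory Submission
  imports Defs
begin

text \<open>
  For \<open>c > 0\<close> one has \<open>1 / sqrt c = (\<integral>y. exp (- (y\<^sup>2 * c)) \<partial>lborel) / sqrt pi\<close>. Writing
  \<open>d\<^sub>R(s, t) = V(s) + V(t) - 2 C(s, t)\<close> with \<open>C\<close> the covariance function of the auxiliary field
  and \<open>V(s) = C(s, s)\<close>, the integrand of \<open>K\<close> becomes a mixture over \<open>y\<close> of the matrices
  \<open>\<beta>\<^sub>i\<^sub>j exp (2 y\<^sup>2 w C(s, t))\<close> multiplied from both sides by a diagonal matrix. Entrywise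
  multiplication of a positive semidefinite matrix by a covariance preserves positive
  semidefiniteness, as does the exponential series formed from such products, and
  so does integration over \<open>y\<close> and \<open>w\<close>. Of the field, only finite second moments matter.
\<close>

section \<open>Closure properties of positive semidefinite matrices\<close>

lemma psd_matrix_cong:
  assumes "\<And>i j. i \<in> I \<Longrightarrow> j \<in> I \<Longrightarrow> Q i j = R i j"
  shows "psd_matrix I Q \<longleftrightarrow> psd_matrix I R"
  using assms unfolding psd_matrix_def by (simp cong: sum.cong)

lemma psd_matrix_scale:
  assumes "psd_matrix I Q"
  shows "psd_matrix I (\<lambda>i j. f i * Q i j * f j)"
  unfolding psd_matrix_def
proof (intro conjI ballI allI)
  fix i j assume "i \<in> I" "j \<in> I"
  then show "f i * Q i j * f j = f j * Q j i * f i"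
    using assms by (simp add: psd_matrix_def mult.commute mult.left_commute)
next
  fix x
  have "0 \<le> (\<Sum>i\<in>I. \<Sum>j\<in>I. (x i * f i) * Q i j * (x j * f j))"
    using assms unfolding psd_matrix_def by (elim conjE allE)
  then show "0 \<le> (\<Sum>i\<in>I. \<Sum>j\<in>I. x i * (f i * Q i j * f j) * x j)"
    by (simp add: mult_ac)
qed

text \<open>Summing \<open>x\<close> over the fibres of \<open>f\<close> gives a vector
  \<open>z\<close> on \<open>J\<close> with the same quadratic form. Since \<open>f\<close> may
  identify indices, the matrix \<beta> can later be copied into every block.\<close>

lemma psd_matrix_pullback:
  assumes "finite I" "psd_matrix J Q" "finite J" "f ` I \<subseteq> J"
  shows "psd_matrix I (\<lambda>i j. Q (f i) (f j))"
  unfolding psd_matrix_def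
proof (intro conjI ballI allI)
  fix i j assume "i \<in> I" "j \<in> I"
  then show "Q (f i) (f j) = Q (f j) (f i)"
    using assms(2,4) unfolding psd_matrix_def by blast
next
  fix x :: "_ \<Rightarrow> real"
  define z where "z a = (\<Sum>i\<in>{i \<in> I. f i = a}. x i)" for a
  have inner: "(\<Sum>j\<in>I. Q a (f j) * x j) = (\<Sum>b\<in>J. Q a b * z b)" for a
    unfolding z_def sum_distrib_left sum.group[OF assms(1,3,4), symmetric]
    by (intro sum.cong) auto
  have "(\<Sum>i\<in>I. \<Sum>j\<in>I. x i * Q (f i) (f j) * x j)
      = (\<Sum>i\<in>I. x i * (\<Sum>b\<in>J. Q (f i) b * z b))"
    by (simp add: inner[symmetric] sum_distrib_left mult.assoc)
  also have "\<dots> = (\<Sum>a\<in>J. z a * (\<Sum>b\<in>J. Q a b * z b))"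
    unfolding z_def sum_distrib_right sum.group[OF assms(1,3,4), symmetric]
    by (intro sum.cong) auto
  also have "\<dots> = (\<Sum>a\<in>J. \<Sum>b\<in>J. z a * Q a b * z b)"
    by (simp add: sum_distrib_left mult.assoc)
  also have "\<dots> \<ge> 0"
    using assms(2) by (simp add: psd_matrix_def)
  finally show "0 \<le> (\<Sum>i\<in>I. \<Sum>j\<in>I. x i * Q (f i) (f j) * x j)" .
qed

lemma psd_matrix_sums:
  assumes psd: "\<And>n. psd_matrix I (Q n)"
    and sums: "\<And>i j. i \<in> I \<Longrightarrow> j \<in> I \<Longrightarrow> (\<lambda>n. Q n i j) sums S i j"
  shows "psd_matrix I S"
  unfolding psd_matrix_def
proof (intro conjI ballI allI)
  fix i j assume ij: "i \<in> I" "j \<in> I"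
  then have "(\<lambda>n. Q n i j) = (\<lambda>n. Q n j i)"
    using psd by (auto simp: psd_matrix_def)
  then show "S i j = S j i"
    using sums[OF ij] sums[OF ij(2) ij(1)] sums_unique2 by metis
next
  fix x
  have nonneg: "0 \<le> (\<Sum>i\<in>I. \<Sum>j\<in>I. x i * Q n i j * x j)" for n
    using psd[of n] unfolding psd_matrix_def by (elim conjE allE)
  have "(\<lambda>n. \<Sum>i\<in>I. \<Sum>j\<in>I. x i * Q n i j * x j) sums (\<Sum>i\<in>I. \<Sum>j\<in>I. x i * S i j * x j)"
    by (intro sums_sum sums_mult sums_mult2 sums)
  then show "0 \<le> (\<Sum>i\<in>I. \<Sum>j\<in>I. x i * S i j * x j)"
    by (rule sums_le[OF nonneg sums_zero])
qed

text \<open>The quadratic form is linear in the entries, so it commutes with the integral, and it is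
  nonnegative at each point. This serves for three measures: that of the probability space, Lebesgue
  measure in \<open>y\<close>, and \<open>F\<close> in \<open>w\<close>.\<close>

lemma psd_matrix_integral:
  assumes psd: "\<And>\<omega>. \<omega> \<in> space M \<Longrightarrow> psd_matrix I (Q \<omega>)"
    and int: "\<And>i j. i \<in> I \<Longrightarrow> j \<in> I \<Longrightarrow> integrable M (\<lambda>\<omega>. Q \<omega> i j)"
  shows "psd_matrix I (\<lambda>i j. \<integral>\<omega>. Q \<omega> i j \<partial>M)"
  unfolding psd_matrix_def
proof (intro conjI ballI allI)
  fix i j assume "i \<in> I" "j \<in> I"
  then show "(\<integral>\<omega>. Q \<omega> i j \<partial>M) = (\<integral>\<omega>. Q \<omega> j i \<partial>M)"
    using psd by (intro Bochner_Integration.integral_cong) (auto simp: psd_matrix_def)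
next
  fix x
  have "0 \<le> (\<integral>\<omega>. (\<Sum>i\<in>I. \<Sum>j\<in>I. x i * Q \<omega> i j * x j) \<partial>M)"
    using psd by (intro Bochner_Integration.integral_nonneg) (auto simp: psd_matrix_def)
  also have "\<dots> = (\<Sum>i\<in>I. \<Sum>j\<in>I. x i * (\<integral>\<omega>. Q \<omega> i j \<partial>M) * x j)"
    using int by (simp add: Bochner_Integration.integral_sum)
  finally show "0 \<le> (\<Sum>i\<in>I. \<Sum>j\<in>I. x i * (\<integral>\<omega>. Q \<omega> i j \<partial>M) * x j)" .
qed

section \<open>Square integrable functions\<close>

text \<open>Measurability is a separate conjunct because it does not follow from that of the
  square.\<close>

definition square_integrable :: "'w measure \<Rightarrow> ('w \<Rightarrow> real) \<Rightarrow> bool" where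
  "square_integrable M f \<longleftrightarrow> f \<in> borel_measurable M \<and> integrable M (\<lambda>\<omega>. (f \<omega>)\<^sup>2)"

lemma square_integrable_cong:
  assumes "\<And>\<omega>. \<omega> \<in> space M \<Longrightarrow> f \<omega> = g \<omega>"
  shows "square_integrable M f \<longleftrightarrow> square_integrable M g"
  using assms unfolding square_integrable_def
  by (simp cong: measurable_cong Bochner_Integration.integrable_cong)

text \<open>The product is dominated by the sum of the squares. This is what makes covariances
  finite.\<close>

lemma integrable_mult_square_integrable:
  assumes "square_integrable M f" "square_integrable M g"
  shows "integrable M (\<lambda>\<omega>. f \<omega> * g \<omega>)"
proof (rule Bochner_Integration.integrable_bound)
  show "integrable M (\<lambda>\<omega>. (f \<omega>)\<^sup>2 + (g \<omega>)\<^sup>2)"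
    using assms by (auto simp: square_integrable_def)
  have "\<bar>f \<omega> * g \<omega>\<bar> \<le> (f \<omega>)\<^sup>2 + (g \<omega>)\<^sup>2" for \<omega>
    using sum_squares_bound[of "\<bar>f \<omega>\<bar>" "\<bar>g \<omega>\<bar>"] abs_ge_zero[of "f \<omega> * g \<omega>"]
    unfolding abs_mult power2_abs by linarith
  then show "AE \<omega> in M. norm (f \<omega> * g \<omega>) \<le> norm ((f \<omega>)\<^sup>2 + (g \<omega>)\<^sup>2)"
    by simp
qed (use assms in \<open>auto simp: square_integrable_def\<close>)

lemma square_integrable_add:
  assumes "square_integrable M f" "square_integrable M g"
  shows "square_integrable M (\<lambda>\<omega>. f \<omega> + g \<omega>)"
  using assms integrable_mult_square_integrable[OF assms]
  by (auto simp: square_integrable_def power2_sum mult.assoc intro!: borel_measurable_add)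

lemma square_integrable_cmult:
  "square_integrable M f \<Longrightarrow> square_integrable M (\<lambda>\<omega>. c * f \<omega>)"
  by (auto simp: square_integrable_def power_mult_distrib)

lemma square_integrable_zero: "square_integrable M (\<lambda>\<omega>. 0)"
  by (simp add: square_integrable_def)

lemma square_integrable_sum:
  assumes "\<And>i. i \<in> I \<Longrightarrow> square_integrable M (f i)"
  shows "square_integrable M (\<lambda>\<omega>. \<Sum>i\<in>I. f i \<omega>)"
  using assms
  by (induction I rule: infinite_finite_induct)
    (auto intro: square_integrable_add square_integrable_zero)

lemma (in finite_measure) square_integrable_const: "square_integrable M (\<lambda>\<omega>. c)"
  by (simp add: square_integrable_def)

section \<open>Entrywise products with second moments and their exponentials\<close>

text \<open>A case of the Schur product theorem without spectral decomposition: for each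
  \<open>\<omega>\<close> the matrix \<open>Q\<close> is scaled from both sides by the values
  \<open>Y i \<omega>\<close>, and then \<open>\<omega>\<close> is integrated out.\<close>

lemma psd_matrix_mult_covariance:
  assumes "psd_matrix I Q" "\<And>i. i \<in> I \<Longrightarrow> square_integrable M (Y i)"
  shows "psd_matrix I (\<lambda>i j. Q i j * (\<integral>\<omega>. Y i \<omega> * Y j \<omega> \<partial>M))"
proof -
  have "psd_matrix I (\<lambda>i j. \<integral>\<omega>. Y i \<omega> * Q i j * Y j \<omega> \<partial>M)"
  proof (intro psd_matrix_integral psd_matrix_scale assms)
    fix i j assume "i \<in> I" "j \<in> I"
    then have "integrable M (\<lambda>\<omega>. Q i j * (Y i \<omega> * Y j \<omega>))"
      by (intro integrable_mult_right integrable_mult_square_integrable assms)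
    then show "integrable M (\<lambda>\<omega>. Y i \<omega> * Q i j * Y j \<omega>)"
      by (simp add: mult_ac)
  qed
  moreover have "(\<integral>\<omega>. Y i \<omega> * Q i j * Y j \<omega> \<partial>M) = Q i j * (\<integral>\<omega>. Y i \<omega> * Y j \<omega> \<partial>M)" for i j
    by (simp add: mult_ac flip: integral_mult_right_zero)
  ultimately show ?thesis by simp
qed

text \<open>Powers of the second moments are multiplied in one factor at a time, starting from
  \<open>Q\<close>; then the exponential series is summed. The condition \<open>0 \<le> c\<close>
  keeps its coefficients nonnegative.\<close>

lemma psd_matrix_mult_exp_covariance:
  assumes "psd_matrix I Q" "\<And>i. i \<in> I \<Longrightarrow> square_integrable M (Y i)" "0 \<le> c"
  shows "psd_matrix I (\<lambda>i j. Q i j * exp (c * (\<integral>\<omega>. Y i \<omega> * Y j \<omega> \<partial>M)))"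
proof -
  let ?C = "\<lambda>i j. \<integral>\<omega>. Y i \<omega> * Y j \<omega> \<partial>M"
  have pow: "psd_matrix I (\<lambda>i j. Q i j * ?C i j ^ n)" for n
  proof (induction n)
    case (Suc n)
    from psd_matrix_mult_covariance[OF this assms(2)] show ?case
      by (simp add: mult_ac)
  qed (simp add: assms)
  show ?thesis
  proof (rule psd_matrix_sums)
    fix n
    \<comment> \<open>A square root of the coefficient, so that multiplying by the coefficient is a
      two-sided scaling by the constant \<open>k\<close>.\<close>
    define k where "k = sqrt (c ^ n / fact n)"
    have k: "k * k = c ^ n / fact n"
      using assms(3) by (simp add: k_def)
    show "psd_matrix I (\<lambda>i j. Q i j * ((c * ?C i j) ^ n /\<^sub>R fact n))"
    proof (rule iffD1[OF psd_matrix_cong psd_matrix_scale[OF pow, of "\<lambda>_. k" n]])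
      show "k * (Q i j * ?C i j ^ n) * k = Q i j * ((c * ?C i j) ^ n /\<^sub>R fact n)" for i j
        using k by (simp add: power_mult_distrib divide_inverse mult_ac)
    qed
  next
    fix i j
    show "(\<lambda>n. Q i j * ((c * ?C i j) ^ n /\<^sub>R fact n)) sums (Q i j * exp (c * ?C i j))"
      by (intro sums_mult exp_converges)
  qed
qed

section \<open>The inverse square root as a Gaussian integral\<close>

text \<open>The integrand is \<open>1 / sqrt c\<close> times a centred normal density. In the
  resulting mixture of exponentials a sum under the root turns into a product.\<close>

lemma has_bochner_integral_exp_square:
  assumes "0 < c"
  shows "has_bochner_integral lborel (\<lambda>y. exp (- (y\<^sup>2 * c)) / sqrt pi) (1 / sqrt c)"
proof -
  \<comment> \<open>Variance \<open>1 / (2 * c)\<close> gives the density the exponent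
    \<open>- (y\<^sup>2 * c)\<close>.\<close>
  define \<sigma> where "\<sigma> = 1 / sqrt (2 * c)"
  have pos: "0 < \<sigma>" and sq: "\<sigma>\<^sup>2 = 1 / (2 * c)"
    using assms by (auto simp: \<sigma>_def power_divide)
  have eq: "exp (- (y\<^sup>2 * c)) / sqrt pi = 1 / sqrt c * normal_density 0 \<sigma> y" for y
    using assms by (simp add: normal_density_def sq real_sqrt_divide real_sqrt_mult field_simps)
  have "has_bochner_integral lborel (normal_density 0 \<sigma>) 1"
    using pos by (simp add: has_bochner_integral_iff integrable_normal_density)
  from has_bochner_integral_mult_right[OF this, of "1 / sqrt c"] show ?thesis
    unfolding eq by simp
qed

section \<open>Finite second moments of the auxiliary field\<close>

text \<open>
  For \<open>V < 0\<close> the library's \<open>sqrt V\<close> is negative; \<open>normal_density\<close> only sees its square.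
\<close>

lemma integrable_square_normal_law: "integrable (normal_law 0 V) (\<lambda>x. x\<^sup>2)"
proof (cases "V = 0")
  case True
  then show ?thesis
    by (simp add: normal_law_def integrable_iff_bounded nn_integral_return)
next
  case False
  have "normal_density 0 (sqrt V) = normal_density 0 \<bar>sqrt V\<bar>"
    by (simp add: normal_density_def fun_eq_iff)
  moreover have "integrable lborel (\<lambda>x. normal_density 0 \<bar>sqrt V\<bar> x * (x - 0)\<^sup>2)"
    using False by (intro integrable_normal_moment) simp
  ultimately show ?thesis
    using False by (simp add: normal_law_def integrable_density normal_density_nonneg)
qed

text \<open>The linear combination with the single index \<open>t\<close> and coefficient
  \<open>1\<close> shows that \<open>X t\<close> itself has law \<open>normal_law 0 (C t t)\<close>,
  whose second moment is finite.\<close>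

lemma square_integrable_centred_gaussian:
  assumes "centred_gaussian M T X C" "t \<in> T"
  shows "square_integrable M (X t)"
proof -
  have meas: "X t \<in> borel_measurable M"
    using assms by (simp add: centred_gaussian_def)
  have "distr M borel (\<lambda>\<omega>. \<Sum>t\<in>{t}. 1 * X t \<omega>) = normal_law 0 (\<Sum>s\<in>{t}. \<Sum>t\<in>{t}. 1 * C s t * 1)"
    using assms unfolding centred_gaussian_def
    by (elim conjE allE[of _ "{t}"] allE[of _ "\<lambda>_. 1"]) simp
  then have "distr M borel (X t) = normal_law 0 (C t t)"
    by simp
  then have "integrable (distr M borel (X t)) (\<lambda>x. x\<^sup>2)"
    using integrable_square_normal_law by simp
  with meas show ?thesis
    by (simp add: square_integrable_def integrable_distr_eq)
qed

text \<open>By interpolation \<open>A 0 s\<close> is a linear combination of two Gaussian vertex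
  values; each of the finitely many other summands is a bridge value or zero.\<close>

lemma square_integrable_total_field:
  fixes v :: "'n::finite \<Rightarrow> real^2"
  assumes v: "bij_betw v UNIV (vertices m e)"
    and A: "auxiliary_fields M m e v r A"
    and s: "s \<in> network m e"
  shows "square_integrable M (total_field m A s)"
proof -
  have vertex: "square_integrable M (A 0 x)" if "x \<in> vertices m e" for x
  proof -
    from that v obtain j where "x = v j"
      by (auto simp: bij_betw_def)
    then show ?thesis
      using A square_integrable_centred_gaussian[of M UNIV "\<lambda>j. A 0 (v j)" _ j]
      by (auto simp: auxiliary_fields_def)
  qed
  \<comment> \<open>Any segment through \<open>s\<close> will do; at a vertex there may be
    several.\<close>
  obtain i u where i: "i \<in> {1..m}" and u: "0 \<le> u" "u \<le> 1"
    and su: "s = (1 - u) *\<^sub>R fst (e i) + u *\<^sub>R snd (e i)"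
    using s by (auto simp: network_def seg_def closed_segment_def)
  have "square_integrable M (\<lambda>\<omega>. (1 - u) * A 0 (fst (e i)) \<omega> + u * A 0 (snd (e i)) \<omega>)"
    using i by (intro square_integrable_add square_integrable_cmult vertex)
      (auto simp: vertices_def endpoints_def)
  moreover have "A 0 s \<omega> = (1 - u) * A 0 (fst (e i)) \<omega> + u * A 0 (snd (e i)) \<omega>"
    if "\<omega> \<in> space M" for \<omega>
  proof -
    have "\<forall>i\<in>{1..m}. \<forall>u\<in>{0..1}. \<forall>\<omega>\<in>space M.
        A 0 ((1 - u) *\<^sub>R fst (e i) + u *\<^sub>R snd (e i)) \<omega>
          = (1 - u) * A 0 (fst (e i)) \<omega> + u * A 0 (snd (e i)) \<omega>"
      using A unfolding auxiliary_fields_def by (elim conjE)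
    with i u that show ?thesis
      unfolding su by (meson atLeastAtMost_iff)
  qed
  ultimately have A0: "square_integrable M (A 0 s)"
    by (simp cong: square_integrable_cong)
  have Ai: "square_integrable M (A i s)" if i: "i \<in> {1..m}" for i
  proof -
    from A i obtain B where B: "brownian_bridge M (seg_length e i) B"
      and AB: "\<And>\<omega>. \<omega> \<in> space M \<Longrightarrow>
        A i s \<omega> = (if s \<in> seg e i then B (dist (fst (e i)) s) \<omega> else 0)"
      using s unfolding auxiliary_fields_def by blast
    show ?thesis
    proof (cases "s \<in> seg e i")
      case True
      \<comment> \<open>The bridge is specified only on \<open>{0..seg_length e i}\<close>, so the
        arc length parameter of \<open>s\<close> has to lie there.\<close>
      then have "dist (fst (e i)) s \<in> {0..seg_length e i}"
        using dist_in_closed_segment[of s "fst (e i)" "snd (e i)"]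
        by (simp add: seg_def seg_length_def dist_commute)
      then have "square_integrable M (B (dist (fst (e i)) s))"
        using B unfolding brownian_bridge_def
        by (elim conjE) (rule square_integrable_centred_gaussian)
      then show ?thesis
        using True AB by (simp cong: square_integrable_cong)
    next
      case False
      then show ?thesis
        using AB square_integrable_zero by (simp cong: square_integrable_cong)
    qed
  qed
  have "square_integrable M (\<lambda>\<omega>. A 0 s \<omega> + (\<Sum>i=1..m. A i s \<omega>))"
    by (intro square_integrable_add square_integrable_sum A0 Ai)
  then show ?thesis
    by (simp add: total_field_def[abs_def])
qed

section \<open>Variances of increments under the inverse square root\<close>

text \<open>The deviation of \<open>X - Z\<close> from its mean is \<open>X' - Z'\<close>, whose
  square is expanded. Square integrability makes the means and all product moments finite.\<close>

lemma (in prob_space) variance_diff: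
  assumes X: "square_integrable M X" and Z: "square_integrable M Z"
  defines "X' \<equiv> \<lambda>\<omega>. X \<omega> - expectation X" and "Z' \<equiv> \<lambda>\<omega>. Z \<omega> - expectation Z"
  shows "variance (\<lambda>\<omega>. X \<omega> - Z \<omega>)
    = expectation (\<lambda>\<omega>. X' \<omega> * X' \<omega>) + expectation (\<lambda>\<omega>. Z' \<omega> * Z' \<omega>)
      - 2 * expectation (\<lambda>\<omega>. X' \<omega> * Z' \<omega>)"
proof -
  have int: "integrable M X" "integrable M Z"
    using X Z by (auto simp: square_integrable_def intro: square_integrable_imp_integrable)
  have X': "square_integrable M X'" and Z': "square_integrable M Z'"
    using square_integrable_add[OF X square_integrable_const[of "- expectation X"]]
      square_integrable_add[OF Z square_integrable_const[of "- expectation Z"]]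
    by (simp_all add: X'_def Z'_def)
  have "variance (\<lambda>\<omega>. X \<omega> - Z \<omega>)
      = expectation (\<lambda>\<omega>. X' \<omega> * X' \<omega> + Z' \<omega> * Z' \<omega> - 2 * (X' \<omega> * Z' \<omega>))"
    using int by (intro Bochner_Integration.integral_cong)
      (auto simp: X'_def Z'_def power2_eq_square algebra_simps)
  also have "\<dots> = expectation (\<lambda>\<omega>. X' \<omega> * X' \<omega>) + expectation (\<lambda>\<omega>. Z' \<omega> * Z' \<omega>)
      - 2 * expectation (\<lambda>\<omega>. X' \<omega> * Z' \<omega>)"
    by (simp add: integrable_mult_square_integrable X' Z')
  finally show ?thesis .
qed

text \<open>For fixed \<open>w\<close> the Gaussian mixture moves the variogram into an exponent.
  There the terms in one index alone become diagonal factors, and the covariance is left with the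
  nonnegative coefficient \<open>2 * y\<^sup>2 * w\<close>.\<close>

lemma psd_matrix_inverse_sqrt_variogram:
  fixes a :: "'p \<Rightarrow> real"
  assumes M: "prob_space M"
    and I: "\<And>p. p \<in> I \<Longrightarrow> square_integrable M (X p)" and Q: "psd_matrix I Q"
    and a: "\<And>p. p \<in> I \<Longrightarrow> 0 < a p" and w: "0 \<le> w"
  shows "psd_matrix I (\<lambda>p q. Q p q / sqrt ((a p + a q) / 2
           + prob_space.variance M (\<lambda>\<omega>. X p \<omega> - X q \<omega>) * w))"
proof -
  interpret prob_space M by fact
  define Y where "Y p \<omega> = X p \<omega> - expectation (X p)" for p \<omega>
  define C where "C p q = expectation (\<lambda>\<omega>. Y p \<omega> * Y q \<omega>)" for p q
  define D where "D p q = variance (\<lambda>\<omega>. X p \<omega> - X q \<omega>)" for p q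
  let ?c = "\<lambda>p q. (a p + a q) / 2 + D p q * w"
  have Y: "square_integrable M (Y p)" if "p \<in> I" for p
    using square_integrable_add[OF I[OF that] square_integrable_const[of "- expectation (X p)"]]
    by (simp add: Y_def[abs_def])
  have d: "D p q = C p p + C q q - 2 * C p q" if "p \<in> I" "q \<in> I" for p q
    using variance_diff[OF I[OF that(1)] I[OF that(2)]] by (simp only: D_def C_def Y_def)
  have D_nonneg: "0 \<le> D p q" for p q
    unfolding D_def by (rule variance_positive)
  have pos: "0 < ?c p q" if "p \<in> I" "q \<in> I" for p q
    using a[OF that(1)] a[OF that(2)] w
    by (intro add_pos_nonneg mult_nonneg_nonneg D_nonneg) auto
  have gauss: "has_bochner_integral lborel
      (\<lambda>y. Q p q * (exp (- (y\<^sup>2 * ?c p q)) / sqrt pi)) (Q p q * (1 / sqrt (?c p q)))"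
    if "p \<in> I" "q \<in> I" for p q
    by (intro has_bochner_integral_mult_right has_bochner_integral_exp_square pos that)
  have "psd_matrix I (\<lambda>p q. Q p q * (exp (- (y\<^sup>2 * ?c p q)) / sqrt pi))" for y
  proof -
    \<comment> \<open>The share of the exponent that depends on one index; each side takes a fourth
      root of pi, so that two factors give \<open>1 / sqrt pi\<close>.\<close>
    define f where "f p = exp (- (y\<^sup>2 * (a p / 2 + w * C p p))) / sqrt (sqrt pi)" for p
    have "psd_matrix I (\<lambda>p q. f p * (Q p q * exp (2 * y\<^sup>2 * w * C p q)) * f q)"
      unfolding C_def using w
      by (intro psd_matrix_scale psd_matrix_mult_exp_covariance Q Y) auto
    moreover have "f p * (Q p q * exp (2 * y\<^sup>2 * w * C p q)) * f q
        = Q p q * (exp (- (y\<^sup>2 * ?c p q)) / sqrt pi)" if "p \<in> I" "q \<in> I" for p q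
    proof -
      have "exp (- (y\<^sup>2 * ?c p q)) = exp (- (y\<^sup>2 * (a p / 2 + w * C p p)))
          * exp (2 * y\<^sup>2 * w * C p q) * exp (- (y\<^sup>2 * (a q / 2 + w * C q q)))"
        unfolding d[OF that] exp_add[symmetric] by (rule arg_cong[of _ _ exp]) algebra
      moreover have "sqrt (sqrt pi) * sqrt (sqrt pi) = sqrt pi"
        by simp
      ultimately show ?thesis
        unfolding f_def by (simp add: divide_simps)
    qed
    ultimately show ?thesis
      by (rule iffD1[OF psd_matrix_cong, rotated])
  qed
  then have "psd_matrix I (\<lambda>p q. \<integral>y. Q p q * (exp (- (y\<^sup>2 * ?c p q)) / sqrt pi) \<partial>lborel)"
    using gauss by (rule psd_matrix_integral[OF _ integrable.intros])
  moreover have "(\<integral>y. Q p q * (exp (- (y\<^sup>2 * ?c p q)) / sqrt pi) \<partial>lborel) = Q p q / sqrt (?c p q)"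
    if "p \<in> I" "q \<in> I" for p q
    using has_bochner_integral_integral_eq[OF gauss[OF that]] by simp
  ultimately show ?thesis
    unfolding D_def[symmetric] by (rule iffD1[OF psd_matrix_cong, rotated])
qed

section \<open>The block matrix and the mixture over \<open>F\<close>\<close>

theorem theorem4p1:
  fixes m :: nat and e :: "nat \<Rightarrow> (real^2) \<times> (real^2)"
    and v :: "'n::finite \<Rightarrow> real^2" and r :: 'n
    and M :: "'w measure" and A :: "nat \<Rightarrow> real^2 \<Rightarrow> 'w \<Rightarrow> real"
    and a b :: "'q::finite \<Rightarrow> real^2 \<Rightarrow> real"
    and \<alpha> :: "'q \<Rightarrow> 'q \<Rightarrow> real^2 \<Rightarrow> real^2 \<Rightarrow> real"
    and \<beta> :: "real^'q^'q" and F :: "real measure"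
    and K :: "real^2 \<Rightarrow> real^2 \<Rightarrow> real^'q^'q"
  assumes "linear_network m e"
    and "bij_betw v UNIV (vertices m e)"
    and "auxiliary_fields M m e v r A"
    and "\<And>i s. s \<in> network m e \<Longrightarrow> 0 < a i s"
    and "\<And>i s. s \<in> network m e \<Longrightarrow> 0 < b i s"
    and "\<And>i j s t. s \<in> network m e \<Longrightarrow> t \<in> network m e \<Longrightarrow> \<alpha> i j s t = (a i s + a j t) / 2"
    and "psd_matrix UNIV (\<lambda>i j. \<beta> $ i $ j)"
    and "finite_measure F" and "sets F = sets (restrict_space borel {0<..})"
    and "\<And>i j s t. s \<in> network m e \<Longrightarrow> t \<in> network m e \<Longrightarrow>
           K s t $ i $ j =
             (\<integral>w. (\<beta> $ i $ j * sqrt (b i s * b j t))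
                  / sqrt (\<alpha> i j s t + resistance_metric M m A s t * w) \<partial>F)"
  shows "psd_kernel (network m e) K"
proof -
  interpret M: prob_space M
    using assms(3) by (simp add: auxiliary_fields_def)
  interpret F: finite_measure F by fact
  let ?L = "network m e"
  let ?d = "resistance_metric M m A"
  have space_F: "space F = {0<..}"
    using sets_eq_imp_space_eq[OF assms(9)] by (simp add: space_restrict_space)
  \<comment> \<open>The sigma-algebra of \<open>F\<close> is the trace of the Borel sets on the
    positive reals, so measurability of the identity is transferred by restriction.\<close>
  have [measurable]: "(\<lambda>w. w) \<in> borel_measurable F"
    using measurable_restrict_space1[of "\<lambda>w::real. w" borel borel "{0<..}"]
      measurable_cong_sets[OF assms(9) refl, of borel] by auto
  have d_nonneg: "0 \<le> ?d s t" for s t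
    unfolding resistance_metric_def by (rule M.variance_positive)
  show ?thesis
    unfolding psd_kernel_def
  proof (intro allI impI)
    fix N :: nat and s :: "nat \<Rightarrow> real^2"
    assume s: "\<forall>k\<in>{1..N}. s k \<in> ?L"
    \<comment> \<open>An index pairs the number of a point with a component. Thus \<open>a\<close>,
      \<open>b\<close> and the field become functions of one index, and \<alpha> becomes an average
      of two values of \<open>a'\<close>.\<close>
    define I where "I = {1..N} \<times> (UNIV :: 'q set)"
    define x where "x p = s (fst p)" for p :: "nat \<times> 'q"
    define a' where "a' p = a (snd p) (x p)" for p
    define b' where "b' p = b (snd p) (x p)" for p
    define Q where "Q p q = sqrt (b' p) * \<beta> $ snd p $ snd q * sqrt (b' q)" for p q
    let ?G = "\<lambda>w p q. Q p q / sqrt ((a' p + a' q) / 2 + ?d (x p) (x q) * w)"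
    have x: "x p \<in> ?L" if "p \<in> I" for p
      using s that by (auto simp: x_def I_def)
    have a': "0 < a' p" if "p \<in> I" for p
      using assms(4) x[OF that] by (simp add: a'_def)
    \<comment> \<open>Every block is a copy of \<beta>, hence the pullback along
      \<open>snd\<close>.\<close>
    have "psd_matrix I (\<lambda>p q. \<beta> $ snd p $ snd q)"
      by (rule psd_matrix_pullback[OF _ assms(7)]) (auto simp: I_def)
    then have Q: "psd_matrix I Q"
      unfolding Q_def by (rule psd_matrix_scale)
    have X: "square_integrable M (total_field m A (x p))" if "p \<in> I" for p
      by (rule square_integrable_total_field[OF assms(2,3) x[OF that]])
    have "psd_matrix I (\<lambda>p q. \<integral>w. ?G w p q \<partial>F)"
    proof (rule psd_matrix_integral)
      fix w assume "w \<in> space F"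
      then show "psd_matrix I (?G w)"
        unfolding resistance_metric_def space_F
        by (intro psd_matrix_inverse_sqrt_variogram M.prob_space_axioms X Q a') auto
    next
      fix p q assume pq: "p \<in> I" "q \<in> I"
      define c where "c = (a' p + a' q) / 2"
      have c: "0 < c"
        using a'[OF pq(1)] a'[OF pq(2)] by (simp add: c_def)
      \<comment> \<open>As \<open>?d\<close> is nonnegative and \<open>w\<close> positive, the
        denominator is at least \<open>sqrt c\<close>; a bounded measurable function is integrable
        for the finite measure \<open>F\<close>.\<close>
      show "integrable F (\<lambda>w. ?G w p q)"
      proof (rule F.integrable_const_bound)
        have "norm (?G w p q) \<le> \<bar>Q p q\<bar> / sqrt c" if "w \<in> space F" for w
        proof -
          have "c \<le> c + ?d (x p) (x q) * w"
            using that d_nonneg[of "x p" "x q"] by (simp add: space_F)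
          then show ?thesis
            using c unfolding c_def[symmetric] by (auto simp: abs_divide intro!: divide_left_mono)
        qed
        then show "AE w in F. norm (?G w p q) \<le> \<bar>Q p q\<bar> / sqrt c"
          by (rule AE_I2)
      qed measurable
    qed
    moreover have "(\<integral>w. ?G w p q \<partial>F) = K (x p) (x q) $ snd p $ snd q" if "p \<in> I" "q \<in> I" for p q
      unfolding assms(10)[OF x[OF that(1)] x[OF that(2)]] assms(6)[OF x[OF that(1)] x[OF that(2)]]
      by (simp add: Q_def a'_def b'_def real_sqrt_mult mult_ac)
    ultimately have "psd_matrix I (\<lambda>p q. K (x p) (x q) $ snd p $ snd q)"
      by (simp cong: psd_matrix_cong)
    then show "psd_matrix ({1..N} \<times> UNIV) (\<lambda>(k, i) (l, j). K (s k) (s l) $ i $ j)"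
      by (simp add: I_def x_def case_prod_unfold)
  qed
qed

end
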